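(* Let $M\subset\mathbb{R}^n$ be a Riemannian submanifold (with the metric induced from $\mathbb{R}^n$), let $\alpha:I\to M$ be a curve with unit tangent $T$ (parametrized by arc length $s$), and let $f:M\to\mathbb{R}$ be a function that is eikonal along $\alpha$. Then $\alpha$ is an $f$-eikonal helix curve if and only if $f$ is a linear function along the curve $\alpha$.
   Context: All objects are smooth and $I\subset\mathbb{R}$ is an interval. $\nabla f$ is the gradient of $f$ on $M$, i.e. the tangent vector field with $\langle\nabla f,X\rangle=X[f]$ for all $X\in TM$. $f$ is eikonal along $\alpha$ if $\|\nabla f\|$ is constant along $\alpha$. When $f$ is eikonal along $\alpha$, $\alpha$ is called an $f$-eikonal helix curve if the angle between $\nabla f$ and $T$ is constant along $\alpha$; since $\|\nabla f\|$ is constant along $\alpha$ and $\|T\|=1$, this means that $\langle\nabla f,T\rangle$ is constant along $\alpha$. "$f$ is a linear function along $\alpha$" means that $f(\alpha(s))=as+b$ for some constants $a,b\in\mathbb{R}$, i.e. $\frac{d}{ds}(f\circ\alpha)$ is constant. *)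

theory Defs
  imports "HOL-Analysis.Analysis"
begin

text \<open>Class \<open>C^k\<close> on an open set of a finite-dimensional space: all iterated directional
  derivatives of order at most \<open>k\<close> exist and are continuous.\<close>

primrec Ck_on :: "nat \<Rightarrow> ('a::euclidean_space \<Rightarrow> 'b::real_normed_vector) \<Rightarrow> 'a set \<Rightarrow> bool" where
  "Ck_on 0 f S \<longleftrightarrow> continuous_on S f"
| "Ck_on (Suc k) f S \<longleftrightarrow>
     (\<forall>x\<in>S. f differentiable (at x)) \<and>
     (\<forall>v. Ck_on k (\<lambda>x. frechet_derivative f (at x) v) S)"

definition Cinf_on :: "('a::euclidean_space \<Rightarrow> 'b::real_normed_vector) \<Rightarrow> 'a set \<Rightarrow> bool" where
  "Cinf_on f S \<longleftrightarrow> open S \<and> (\<forall>k. Ck_on k f S)"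

text \<open>A map on an arbitrary set is smooth if it extends, locally around each point of the set, to a
  smooth map on an open set. For an embedded submanifold this is the usual notion of smoothness;
  for an interval it amounts to one-sided derivatives of all orders at the endpoints it contains.\<close>

definition smooth_map_on :: "'a::euclidean_space set \<Rightarrow> ('a \<Rightarrow> 'b::real_normed_vector) \<Rightarrow> bool" where
  "smooth_map_on S f \<longleftrightarrow>
     (\<forall>p\<in>S. \<exists>U F. p \<in> U \<and> Cinf_on F U \<and> (\<forall>x\<in>S \<inter> U. F x = f x))"

text \<open>Embedded \<open>k\<close>-dimensional smooth submanifold, by slice charts; a \<open>k\<close>-dimensional linear
  subspace \<open>E\<close> of the ambient space plays the role of the coordinate slice.\<close>

definition embedded_submanifold :: "nat \<Rightarrow> 'a::euclidean_space set \<Rightarrow> bool" where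
  "embedded_submanifold k M \<longleftrightarrow>
     (\<forall>p\<in>M. \<exists>W V \<phi> \<psi> E. p \<in> W \<and>
        homeomorphism W V \<phi> \<psi> \<and> Cinf_on \<phi> W \<and> Cinf_on \<psi> V \<and>
        subspace E \<and> dim E = k \<and> \<phi> ` (M \<inter> W) = V \<inter> (E :: 'a set))"

definition represents_tangent ::
    "'a::euclidean_space set \<Rightarrow> 'a \<Rightarrow> 'a \<Rightarrow> (real \<Rightarrow> 'a) \<Rightarrow> bool" where
  "represents_tangent M p X \<gamma> \<longleftrightarrow>
     (\<exists>\<epsilon>>0. Cinf_on \<gamma> {-\<epsilon><..<\<epsilon>} \<and> \<gamma> ` {-\<epsilon><..<\<epsilon>} \<subseteq> M) \<and>
     \<gamma> 0 = p \<and> (\<gamma> has_vector_derivative X) (at 0)"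

definition tangent_space :: "'a::euclidean_space set \<Rightarrow> 'a \<Rightarrow> 'a set" where
  "tangent_space M p = {X. \<exists>\<gamma>. represents_tangent M p X \<gamma>}"

text \<open>The derivative \<open>X[f]\<close> of a function on \<open>M\<close> in the direction of a tangent vector \<open>X\<close> at
  \<open>p\<close>: the common derivative of \<open>f\<close> along the curves in \<open>M\<close> representing \<open>X\<close>. Only the values
  of \<open>f\<close> on \<open>M\<close> matter.\<close>

definition tangent_deriv ::
    "'a::euclidean_space set \<Rightarrow> ('a \<Rightarrow> real) \<Rightarrow> 'a \<Rightarrow> 'a \<Rightarrow> real" where
  "tangent_deriv M f p X =
     (THE d. \<forall>\<gamma>. represents_tangent M p X \<gamma> \<longrightarrow> ((\<lambda>t. f (\<gamma> t)) has_real_derivative d) (at 0))"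

text \<open>The Riemannian metric is the one induced from the ambient space, so it is the restriction of
  the ambient inner product to the tangent spaces.\<close>

definition grad :: "'a::euclidean_space set \<Rightarrow> ('a \<Rightarrow> real) \<Rightarrow> 'a \<Rightarrow> 'a" where
  "grad M f p =
     (THE g. g \<in> tangent_space M p \<and>
             (\<forall>X\<in>tangent_space M p. g \<bullet> X = tangent_deriv M f p X))"

definition curve_tangent :: "(real \<Rightarrow> 'a::euclidean_space) \<Rightarrow> real set \<Rightarrow> real \<Rightarrow> 'a" where
  "curve_tangent \<alpha> I s = vector_derivative \<alpha> (at s within I)"

text \<open>Intervals may be open, closed or half-open, bounded or unbounded, but must contain more than
  one point, as otherwise a curve has no tangent.\<close>

definition unit_speed_curve :: "real set \<Rightarrow> 'a::euclidean_space set \<Rightarrow> (real \<Rightarrow> 'a) \<Rightarrow> bool" where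
  "unit_speed_curve I M \<alpha> \<longleftrightarrow>
     is_interval I \<and> interior I \<noteq> {} \<and> \<alpha> ` I \<subseteq> M \<and> smooth_map_on I \<alpha> \<and>
     (\<forall>s\<in>I. norm (curve_tangent \<alpha> I s) = 1)"

text \<open>If one of the vectors is zero, the value is \<open>pi / 2\<close>; thus
  \<open>u \<bullet> v = norm u * norm v * cos (angle u v)\<close> always holds.\<close>

definition angle :: "'a::real_inner \<Rightarrow> 'a \<Rightarrow> real" where
  "angle u v = arccos ((u \<bullet> v) / (norm u * norm v))"

definition eikonal_along ::
    "'a::euclidean_space set \<Rightarrow> ('a \<Rightarrow> real) \<Rightarrow> real set \<Rightarrow> (real \<Rightarrow> 'a) \<Rightarrow> bool" where
  "eikonal_along M f I \<alpha> \<longleftrightarrow> (\<exists>c. \<forall>s\<in>I. norm (grad M f (\<alpha> s)) = c)"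

definition eikonal_helix ::
    "'a::euclidean_space set \<Rightarrow> ('a \<Rightarrow> real) \<Rightarrow> real set \<Rightarrow> (real \<Rightarrow> 'a) \<Rightarrow> bool" where
  "eikonal_helix M f I \<alpha> \<longleftrightarrow>
     eikonal_along M f I \<alpha> \<and>
     (\<exists>\<theta>. \<forall>s\<in>I. angle (grad M f (\<alpha> s)) (curve_tangent \<alpha> I s) = \<theta>)"

definition linear_along :: "('a \<Rightarrow> real) \<Rightarrow> real set \<Rightarrow> (real \<Rightarrow> 'a) \<Rightarrow> bool" where
  "linear_along f I \<alpha> \<longleftrightarrow> (\<exists>a b. \<forall>s\<in>I. f (\<alpha> s) = a * s + b)"

end

theory Submission
  imports Defs
begin

text \<open>By the chain rule, \<open>f \<circ> \<alpha>\<close> has derivative \<open>grad f \<bullet> T\<close> along \<open>\<alpha>\<close>, which is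
  \<open>norm (grad f)\<close> times the cosine of the angle. So the angle is constant if and only if
  \<open>f \<circ> \<alpha>\<close> has constant derivative, that is, if and only if it is affine. The substance lies in
  making sense of \<open>grad f\<close>: in a slice chart with inverse \<open>\<psi>\<close> and slice \<open>E\<close> the tangent space is
  the image of \<open>E\<close> under the derivative of \<open>\<psi>\<close>, hence a subspace, and the gradient is the
  orthogonal projection onto it of the gradient of a local smooth extension of \<open>f\<close>. This
  description also shows that \<open>T\<close> is tangent at an endpoint of the interval, where \<open>\<alpha>\<close> is not
  itself a representing curve.\<close>

section \<open>Differential calculus in Euclidean spaces\<close>

lemma Ck_on_cong:
  assumes "open S" "\<And>x. x \<in> S \<Longrightarrow> f x = g x" "Ck_on k f S"
  shows "Ck_on k g S"
  using assms(2,3)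
proof (induction k arbitrary: f g)
  case 0
  then show ?case by (simp cong: continuous_on_cong)
next
  case (Suc k)
  have der: "(g has_derivative frechet_derivative f (at x)) (at x)" if "x \<in> S" for x
  proof (rule has_derivative_transform_within_open[OF _ assms(1) that])
    show "(f has_derivative frechet_derivative f (at x)) (at x)"
      using Suc.prems(2) that by (auto intro: iffD1[OF frechet_derivative_works])
  qed (use Suc.prems(1) in auto)
  have "Ck_on k (\<lambda>x. frechet_derivative g (at x) v) S" for v
  proof (rule Suc.IH)
    show "Ck_on k (\<lambda>x. frechet_derivative f (at x) v) S"
      using Suc.prems(2) by simp
    show "frechet_derivative f (at x) v = frechet_derivative g (at x) v" if "x \<in> S" for x
      using frechet_derivative_at[OF der[OF that]] by simp
  qed
  moreover have "g differentiable (at x)" if "x \<in> S" for x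
    using der[OF that] by (auto simp: differentiable_def)
  ultimately show ?case by simp
qed

text \<open>For an affine inner map, the derivative of the composite in direction \<open>v\<close>
  is the derivative of \<open>f\<close> in the fixed direction \<open>L v\<close>, composed with the
  same map. The induction thus reproduces its own form, with no product rule. It serves for curves
  that are straight lines in a chart.\<close>

lemma Ck_on_compose_affine:
  fixes L :: "'c::euclidean_space \<Rightarrow> 'a::euclidean_space"
  assumes "open T" "bounded_linear L" "\<And>t. t \<in> T \<Longrightarrow> q + L t \<in> S" "Ck_on k f S"
  shows "Ck_on k (\<lambda>t. f (q + L t)) T"
  using assms(4)
proof (induction k arbitrary: f)
  case 0
  have "continuous_on T (\<lambda>t. q + L t)"
    by (intro continuous_intros bounded_linear.continuous_on[OF assms(2)])
  then have "continuous_on T (f \<circ> (\<lambda>t. q + L t))"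
    using 0 assms(3) by (intro continuous_on_compose) (auto intro: continuous_on_subset)
  then show ?case by (simp add: o_def)
next
  case (Suc k)
  have der: "((\<lambda>t. f (q + L t)) has_derivative (\<lambda>v. frechet_derivative f (at (q + L t)) (L v))) (at t)"
    if "t \<in> T" for t
  proof -
    have 1: "((\<lambda>t. q + L t) has_derivative L) (at t)"
      using has_derivative_add[OF has_derivative_const bounded_linear_imp_has_derivative[OF assms(2)]]
      by simp
    have 2: "(f has_derivative frechet_derivative f (at (q + L t))) (at (q + L t))"
      using Suc.prems assms(3)[OF that] by (auto intro: iffD1[OF frechet_derivative_works])
    show ?thesis using diff_chain_at[OF 1 2] by (simp add: o_def)
  qed
  have "Ck_on k (\<lambda>t. frechet_derivative (\<lambda>t. f (q + L t)) (at t) v) T" for v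
  proof (rule Ck_on_cong[OF assms(1)])
    show "Ck_on k (\<lambda>t. frechet_derivative f (at (q + L t)) (L v)) T"
      using Suc.IH[of "\<lambda>x. frechet_derivative f (at x) (L v)"] Suc.prems by simp
    show "frechet_derivative f (at (q + L t)) (L v) = frechet_derivative (\<lambda>t. f (q + L t)) (at t) v"
      if "t \<in> T" for t
      using fun_cong[OF frechet_derivative_at[OF der[OF that]], of v] .
  qed
  moreover have "(\<lambda>t. f (q + L t)) differentiable (at t)" if "t \<in> T" for t
    using der[OF that] by (auto simp: differentiable_def)
  ultimately show ?case by simp
qed

lemma Cinf_on_has_derivative:
  assumes "Cinf_on F U" "x \<in> U"
  shows "(F has_derivative frechet_derivative F (at x)) (at x)"
proof -
  have "Ck_on (Suc 0) F U" using assms(1) unfolding Cinf_on_def by blast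
  then show ?thesis using assms(2) by (auto intro: iffD1[OF frechet_derivative_works])
qed

text \<open>The difference quotients lie in \<open>E\<close>, and a subspace of a finite-dimensional
  space is closed, so their limit lies in \<open>E\<close> too. The derivative may be
  one-sided.\<close>

lemma has_vector_derivative_in_subspace:
  fixes E :: "'a::euclidean_space set"
  assumes der: "(g has_vector_derivative y) (at s within I)"
    and "at s within I \<noteq> bot" "subspace E" "g s \<in> E"
    and ev: "\<forall>\<^sub>F t in at s within I. g t \<in> E"
  shows "y \<in> E"
proof (rule Lim_in_closed_set)
  have "((\<lambda>t. (g t - g s - (t - s) *\<^sub>R y) /\<^sub>R norm (t - s)) \<longlongrightarrow> 0) (at s within I)"
    using der by (simp add: has_vector_derivative_def has_derivative_at_within)
  then have "((\<lambda>t. (g t - g s) /\<^sub>R (t - s) - y) \<longlongrightarrow> 0) (at s within I)"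
  proof (rule Lim_transform_eventually[OF iffD2[OF tendsto_norm_zero_iff], THEN tendsto_norm_zero_cancel])
    \<comment> \<open>The definition of the derivative divides by the absolute value of
      \<open>t - s\<close>, the difference quotient by \<open>t - s\<close> itself. The two agree up
      to sign, hence in norm.\<close>
    have "norm ((g t - g s - (t - s) *\<^sub>R y) /\<^sub>R norm (t - s)) = norm ((g t - g s) /\<^sub>R (t - s) - y)"
      if "t \<noteq> s" for t
    proof -
      have "(g t - g s) /\<^sub>R (t - s) - y = (g t - g s - (t - s) *\<^sub>R y) /\<^sub>R (t - s)"
        using that by (simp add: scaleR_diff_right)
      then show ?thesis by simp
    qed
    then show "\<forall>\<^sub>F t in at s within I.
        norm ((g t - g s - (t - s) *\<^sub>R y) /\<^sub>R norm (t - s)) = norm ((g t - g s) /\<^sub>R (t - s) - y)"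
      by (simp add: eventually_at_filter)
  qed
  then show "((\<lambda>t. (g t - g s) /\<^sub>R (t - s)) \<longlongrightarrow> y) (at s within I)"
    by (rule LIM_zero_cancel)
  show "\<forall>\<^sub>F t in at s within I. (g t - g s) /\<^sub>R (t - s) \<in> E"
    using ev by eventually_elim (use assms in \<open>auto intro: subspace_scale subspace_diff\<close>)
qed (use assms closed_subspace in auto)

section \<open>Tangent spaces in a slice chart\<close>

locale slice_chart =
  fixes M W V E :: "'a::euclidean_space set" and \<phi> \<psi> :: "'a \<Rightarrow> 'a"
  assumes homeo: "homeomorphism W V \<phi> \<psi>"
    and smooth: "Cinf_on \<phi> W" "Cinf_on \<psi> V"
    and subspace: "subspace E"
    and slice: "\<phi> ` (M \<inter> W) = V \<inter> E"
begin

text \<open>In the chart the curve runs inside \<open>E\<close>, hence so does its velocity, and the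
  derivative of \<psi> carries that velocity back to \<open>X\<close>. Working within
  \<open>I\<close> covers both the curves that represent tangent vectors and a curve at an endpoint
  of its interval.\<close>

lemma curve_velocity_in_image:
  assumes "(\<gamma> has_vector_derivative X) (at s within I)" "at s within I \<noteq> bot"
    and "s \<in> I" "\<gamma> ` I \<subseteq> M" "\<gamma> s \<in> W"
  shows "X \<in> frechet_derivative \<psi> (at (\<phi> (\<gamma> s))) ` E"
proof -
  let ?p = "\<gamma> s"
  let ?A = "frechet_derivative \<phi> (at ?p)" and ?B = "frechet_derivative \<psi> (at (\<phi> ?p))"
  have "open W" using smooth(1) by (simp add: Cinf_on_def)
  have "\<phi> ?p \<in> V" using homeo assms(5) by (auto simp: homeomorphism_def)
  have A: "(\<phi> has_derivative ?A) (at ?p)"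
    using Cinf_on_has_derivative[OF smooth(1) assms(5)] .
  have B: "(\<psi> has_derivative ?B) (at (\<phi> ?p))"
    using Cinf_on_has_derivative[OF smooth(2) \<open>\<phi> ?p \<in> V\<close>] .
  \<comment> \<open>Differentiating the identity \<psi> \<circ> \<phi> on the open set
    \<open>W\<close> makes \<open>?B\<close> a left inverse of \<open>?A\<close>.\<close>
  have "((\<psi> \<circ> \<phi>) has_derivative ?B \<circ> ?A) (at ?p)"
    using diff_chain_at[OF A B] .
  moreover have "((\<psi> \<circ> \<phi>) has_derivative (\<lambda>x. x)) (at ?p)"
    by (rule has_derivative_transform_within_open[OF has_derivative_ident \<open>open W\<close> assms(5)])
      (use homeo in \<open>auto simp: homeomorphism_def\<close>)
  ultimately have "?B \<circ> ?A = (\<lambda>x. x)" by (rule has_derivative_unique)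
  then have BA: "?B (?A X) = X" by (metis comp_apply)
  have "(\<phi> \<circ> \<gamma> has_vector_derivative ?A X) (at s within I)"
    using vector_derivative_diff_chain_within[OF assms(1)] A has_derivative_at_withinI by blast
  moreover have "\<forall>\<^sub>F t in at s within I. (\<phi> \<circ> \<gamma>) t \<in> E"
  proof -
    have "(\<gamma> \<longlongrightarrow> ?p) (at s within I)"
      using has_vector_derivative_continuous[OF assms(1)] by (simp add: continuous_within)
    then have "\<forall>\<^sub>F t in at s within I. \<gamma> t \<in> W"
      using topological_tendstoD \<open>open W\<close> assms(5) by blast
    moreover have "\<forall>\<^sub>F t in at s within I. t \<in> I"
      by (simp add: eventually_at_filter)
    ultimately show ?thesis
      by eventually_elim (use assms(4) slice in auto)
  qed
  moreover have "(\<phi> \<circ> \<gamma>) s \<in> E" using assms slice by auto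
  ultimately have "?A X \<in> E"
    using has_vector_derivative_in_subspace assms(2) subspace by blast
  then show ?thesis using BA by (metis imageI)
qed

lemma tangent_space_eq:
  assumes "p \<in> M" "p \<in> W"
  shows "tangent_space M p = frechet_derivative \<psi> (at (\<phi> p)) ` E"
proof (intro equalityI subsetI)
  fix X assume "X \<in> tangent_space M p"
  then obtain \<gamma> \<epsilon> where g: "\<epsilon> > 0" "\<gamma> ` {-\<epsilon><..<\<epsilon>} \<subseteq> M" "\<gamma> 0 = p"
    "(\<gamma> has_vector_derivative X) (at 0)"
    unfolding tangent_space_def represents_tangent_def by blast
  have "at (0::real) within {-\<epsilon><..<\<epsilon>} = at 0"
    using g(1) by (intro at_within_open) auto
  then show "X \<in> frechet_derivative \<psi> (at (\<phi> p)) ` E"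
    using curve_velocity_in_image[of \<gamma> X 0 "{-\<epsilon><..<\<epsilon>}"] g assms(2) by simp
next
  fix X assume "X \<in> frechet_derivative \<psi> (at (\<phi> p)) ` E"
  then obtain e where e: "e \<in> E" "X = frechet_derivative \<psi> (at (\<phi> p)) e" by blast
  \<comment> \<open>The line through the chart image of \<open>p\<close> in direction
    \<open>e\<close> stays in \<open>E\<close>, and in \<open>V\<close> for small parameters. Its
    image under \<psi> is the curve in \<open>M\<close> that represents \<open>X\<close>.\<close>
  define l where "l t = \<phi> p + t *\<^sub>R e" for t :: real
  have "open V" using smooth(2) by (simp add: Cinf_on_def)
  have pV: "\<phi> p \<in> V" "\<phi> p \<in> E" using slice assms by auto
  have l: "(l has_vector_derivative e) (at t)" for t
    unfolding l_def by (auto intro!: derivative_eq_intros)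
  have "open (l -` V)"
    using l has_vector_derivative_continuous
    by (intro open_vimage \<open>open V\<close> continuous_at_imp_continuous_on) blast
  moreover have "0 \<in> l -` V" using pV by (simp add: l_def)
  ultimately obtain \<epsilon> where eps: "\<epsilon> > 0" "ball 0 \<epsilon> \<subseteq> l -` V"
    by (meson openE)
  have lV: "l t \<in> V" if "t \<in> {-\<epsilon><..<\<epsilon>}" for t
    using eps that by (auto simp: subset_iff dist_real_def)
  have "Cinf_on (\<psi> \<circ> l) {-\<epsilon><..<\<epsilon>}"
    unfolding Cinf_on_def
  proof (intro conjI allI)
    fix k
    have "Ck_on k \<psi> V" using smooth(2) by (simp add: Cinf_on_def)
    then have "Ck_on k (\<lambda>t. \<psi> (\<phi> p + t *\<^sub>R e)) {-\<epsilon><..<\<epsilon>}"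
      using lV by (intro Ck_on_compose_affine bounded_linear_scaleR_left) (auto simp: l_def)
    then show "Ck_on k (\<psi> \<circ> l) {-\<epsilon><..<\<epsilon>}" by (simp add: l_def o_def)
  qed simp
  moreover have "(\<psi> \<circ> l) ` {-\<epsilon><..<\<epsilon>} \<subseteq> M"
  proof clarify
    fix t assume "t \<in> {-\<epsilon><..<\<epsilon>}"
    moreover have "l t \<in> E" unfolding l_def by (intro subspace_add subspace_scale subspace pV e)
    ultimately have "l t \<in> \<phi> ` (M \<inter> W)" using lV slice by simp
    then show "(\<psi> \<circ> l) t \<in> M" using homeo by (auto simp: homeomorphism_def)
  qed
  moreover have "(\<psi> \<circ> l) 0 = p" using homeo assms(2) by (simp add: l_def homeomorphism_def)
  moreover have "(\<psi> \<circ> l has_vector_derivative X) (at 0)"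
  proof -
    have "(\<psi> has_derivative frechet_derivative \<psi> (at (\<phi> p))) (at (l 0) within range l)"
      using Cinf_on_has_derivative[OF smooth(2) pV(1)] has_derivative_at_withinI
      by (fastforce simp: l_def)
    from vector_derivative_diff_chain_within[OF l this] show ?thesis by (simp add: e)
  qed
  ultimately show "X \<in> tangent_space M p"
    using eps(1) unfolding tangent_space_def represents_tangent_def by blast
qed

lemma subspace_tangent_space:
  assumes "p \<in> M" "p \<in> W"
  shows "Real_Vector_Spaces.subspace (tangent_space M p)"
proof -
  have "\<phi> p \<in> V" using slice assms by auto
  then have "linear (frechet_derivative \<psi> (at (\<phi> p)))"
    using Cinf_on_has_derivative[OF smooth(2)] has_derivative_linear by blast
  then show ?thesis
    by (simp add: tangent_space_eq[OF assms] linear_subspace_image subspace)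
qed

end

lemma embedded_submanifold_chart:
  assumes "embedded_submanifold k M" "p \<in> M"
  obtains W V E \<phi> \<psi> where "slice_chart M W V E \<phi> \<psi>" "p \<in> W"
  using assms unfolding embedded_submanifold_def slice_chart_def by metis

section \<open>Derivatives along curves and the gradient\<close>

lemma extension_deriv_along_curve:
  assumes "p = \<gamma> s" "(\<gamma> has_vector_derivative X) (at s within I)" "s \<in> I" "\<gamma> ` I \<subseteq> M"
    and "Cinf_on F U" "p \<in> U" "\<And>x. x \<in> M \<inter> U \<Longrightarrow> F x = f x"
  shows "((\<lambda>t. f (\<gamma> t)) has_real_derivative frechet_derivative F (at p) X) (at s within I)"
proof -
  have F: "(F has_derivative frechet_derivative F (at p)) (at (\<gamma> s) within \<gamma> ` I)"
    using Cinf_on_has_derivative[OF assms(5,6)] assms(1) has_derivative_at_withinI by blast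
  have "((\<lambda>t. F (\<gamma> t)) has_vector_derivative frechet_derivative F (at p) X) (at s within I)"
    using vector_derivative_diff_chain_within[OF assms(2) F] by (simp add: o_def)
  moreover have "\<forall>\<^sub>F t in at s within I. F (\<gamma> t) = f (\<gamma> t)"
  proof -
    have "(\<gamma> \<longlongrightarrow> p) (at s within I)"
      using has_vector_derivative_continuous[OF assms(2)] assms(1) by (simp add: continuous_within)
    then have "\<forall>\<^sub>F t in at s within I. \<gamma> t \<in> U"
      using topological_tendstoD assms(5,6) unfolding Cinf_on_def by blast
    moreover have "\<forall>\<^sub>F t in at s within I. t \<in> I"
      by (simp add: eventually_at_filter)
    ultimately show ?thesis
      by eventually_elim (use assms(4,7) in auto)
  qed
  \<comment> \<open>The filter leaves out the point \<open>s\<close>, so agreement there is a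
    separate condition.\<close>
  moreover have "F (\<gamma> s) = f (\<gamma> s)" using assms by auto
  ultimately show ?thesis
    unfolding has_real_derivative_iff_has_vector_derivative has_vector_derivative_def
    by (rule has_derivative_transform_eventually[OF _ _ _ assms(3)])
qed

text \<open>Every curve representing \<open>X\<close> gives the same value, computed from a local
  extension \<open>F\<close>. At least one such curve exists, so the value is unique and the
  definite description in \<open>tangent_deriv\<close> denotes it.\<close>

lemma tangent_deriv_eq:
  assumes "X \<in> tangent_space M p"
    and "Cinf_on F U" "p \<in> U" "\<And>x. x \<in> M \<inter> U \<Longrightarrow> F x = f x"
  shows "tangent_deriv M f p X = frechet_derivative F (at p) X"
proof -
  have *: "((\<lambda>t. f (\<gamma> t)) has_real_derivative frechet_derivative F (at p) X) (at 0)"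
    if rep: "represents_tangent M p X \<gamma>" for \<gamma>
  proof -
    obtain \<epsilon> where g: "\<epsilon> > 0" "\<gamma> ` {-\<epsilon><..<\<epsilon>} \<subseteq> M" "\<gamma> 0 = p" "(\<gamma> has_vector_derivative X) (at 0)"
      using rep unfolding represents_tangent_def by blast
    have "at (0::real) within {-\<epsilon><..<\<epsilon>} = at 0"
      using g(1) by (intro at_within_open) auto
    then show ?thesis
      using extension_deriv_along_curve[of p \<gamma> 0 X "{-\<epsilon><..<\<epsilon>}" M F U f] g assms(2-4) by simp
  qed
  obtain \<gamma> where "represents_tangent M p X \<gamma>"
    using assms(1) unfolding tangent_space_def by blast
  then show ?thesis
    unfolding tangent_deriv_def using * DERIV_unique by (intro the_equality) blast+
qed

text \<open>Represent \<open>h\<close> by a vector of the whole space and project it orthogonally to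
  \<open>S\<close>: the discarded component is orthogonal to \<open>S\<close> and does not change
  inner products with elements of \<open>S\<close>. Two solutions differ by an element of
  \<open>S\<close> orthogonal to itself.\<close>

lemma subspace_Riesz:
  fixes S :: "'a::euclidean_space set" and h :: "'a \<Rightarrow> real"
  assumes "subspace S" "linear h"
  shows "\<exists>!g. g \<in> S \<and> (\<forall>X\<in>S. g \<bullet> X = h X)"
proof (rule ex_ex1I)
  define v where "v = adjoint h 1"
  have v: "v \<bullet> X = h X" for X
    using adjoint_works[OF assms(2), of X 1] by (simp add: v_def inner_commute)
  obtain g z where gz: "g \<in> span S" "\<And>w. w \<in> span S \<Longrightarrow> orthogonal z w" "v = g + z"
    using orthogonal_subspace_decomp_exists by metis
  have "span S = S" using assms(1) by (simp add: span_eq_iff)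
  then have "g \<in> S \<and> (\<forall>X\<in>S. g \<bullet> X = h X)"
    using gz v by (metis add.right_neutral inner_add_left orthogonal_def)
  then show "\<exists>g. g \<in> S \<and> (\<forall>X\<in>S. g \<bullet> X = h X)" by blast
next
  fix g g' assume g: "g \<in> S \<and> (\<forall>X\<in>S. g \<bullet> X = h X)" "g' \<in> S \<and> (\<forall>X\<in>S. g' \<bullet> X = h X)"
  then have "g - g' \<in> S" using assms(1) by (simp add: subspace_diff)
  then have "(g - g') \<bullet> (g - g') = 0" using g by (metis inner_diff_left diff_self)
  then show "g = g'" by simp
qed

text \<open>Both sides equal the derivative at \<open>\<gamma> s\<close> of a local smooth extension
  of \<open>f\<close>, applied to \<open>X\<close>.\<close>

lemma deriv_along_curve_eq_grad:
  assumes M: "embedded_submanifold k M" and f: "smooth_map_on M f"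
    and \<gamma>: "(\<gamma> has_vector_derivative X) (at s within I)" "at s within I \<noteq> bot"
    "s \<in> I" "\<gamma> ` I \<subseteq> M"
  shows "((\<lambda>t. f (\<gamma> t)) has_real_derivative grad M f (\<gamma> s) \<bullet> X) (at s within I)"
proof -
  define p where "p = \<gamma> s"
  have "p \<in> M" using \<gamma> by (auto simp: p_def)
  then obtain W V E \<phi> \<psi> where chart: "slice_chart M W V E \<phi> \<psi>" and "p \<in> W"
    using embedded_submanifold_chart[OF M] by blast
  interpret slice_chart M W V E \<phi> \<psi> by (rule chart)
  let ?T = "tangent_space M p"
  obtain U F where F: "p \<in> U" "Cinf_on F U" "\<And>x. x \<in> M \<inter> U \<Longrightarrow> F x = f x"
    using f \<open>p \<in> M\<close> unfolding smooth_map_on_def by meson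
  let ?h = "frechet_derivative F (at p)"
  have "linear ?h"
    using Cinf_on_has_derivative[OF F(2,1)] has_derivative_linear by blast
  have td: "tangent_deriv M f p Y = ?h Y" if "Y \<in> ?T" for Y
    using tangent_deriv_eq[OF that F(2,1,3)] .
  \<comment> \<open>The tangential derivative agrees on \<open>?T\<close> with the linear map
    \<open>?h\<close>, so the Riesz argument shows that the description in \<open>grad\<close> has
    exactly one solution.\<close>
  have "\<exists>!g. g \<in> ?T \<and> (\<forall>Y\<in>?T. g \<bullet> Y = tangent_deriv M f p Y)"
    using subspace_Riesz[OF subspace_tangent_space[OF \<open>p \<in> M\<close> \<open>p \<in> W\<close>] \<open>linear ?h\<close>]
    by (simp add: td cong: conj_cong ball_cong)
  from theI'[OF this] have g: "\<forall>Y\<in>?T. grad M f p \<bullet> Y = tangent_deriv M f p Y"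
    unfolding grad_def by blast
  \<comment> \<open>If \<open>s\<close> is an endpoint of \<open>I\<close>, the curve need not
    continue past it, so tangency of \<open>X\<close> comes from the chart description instead of a
    representing curve.\<close>
  have "X \<in> ?T"
    using curve_velocity_in_image[OF \<gamma>] \<open>p \<in> W\<close> tangent_space_eq[OF \<open>p \<in> M\<close> \<open>p \<in> W\<close>]
    by (simp add: p_def)
  then have "grad M f p \<bullet> X = ?h X" using g td by simp
  then show ?thesis
    using extension_deriv_along_curve[OF p_def \<gamma>(1,3,4) F(2,1,3)] by (simp add: p_def)
qed

section \<open>One-variable calculus on intervals, and angles\<close>

lemma at_within_interval_neq_bot:
  fixes I :: "real set"
  assumes "is_interval I" "interior I \<noteq> {}" "s \<in> I"
  shows "at s within I \<noteq> bot"
proof -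
  have "\<not> I \<subseteq> {s}" using assms(2) interior_mono[of I "{s}"] by auto
  then have "s islimpt I"
    using assms is_interval_connected connected_imp_perfect by blast
  then show ?thesis by (simp add: trivial_limit_within)
qed

text \<open>\<open>curve_tangent\<close> is a chosen value that means something only where the curve
  is differentiable within \<open>I\<close>. A local smooth extension gives this differentiability,
  also at endpoints.\<close>

lemma unit_speed_curve_has_vector_derivative:
  assumes "unit_speed_curve I M \<alpha>" "s \<in> I"
  shows "(\<alpha> has_vector_derivative curve_tangent \<alpha> I s) (at s within I)"
proof -
  obtain U A where A: "s \<in> U" "Cinf_on A U" "\<forall>x\<in>I \<inter> U. A x = \<alpha> x"
    using assms unfolding unit_speed_curve_def smooth_map_on_def by meson
  have "open U" using A(2) by (simp add: Cinf_on_def)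
  have "(A has_derivative frechet_derivative A (at s)) (at s within I)"
    using Cinf_on_has_derivative[OF A(2,1)] has_derivative_at_withinI by blast
  moreover have "\<forall>\<^sub>F t in at s within I. A t = \<alpha> t"
    using \<open>open U\<close> A(1,3) by (auto simp: eventually_at_topological)
  moreover have "A s = \<alpha> s" using A(1,3) assms(2) by auto
  ultimately have "(\<alpha> has_derivative frechet_derivative A (at s)) (at s within I)"
    using has_derivative_transform_eventually assms(2) by blast
  then have "\<alpha> differentiable (at s within I)" by (auto simp: differentiable_def)
  then show ?thesis
    unfolding curve_tangent_def using vector_derivative_works by blast
qed

text \<open>By Cauchy-Schwarz the argument of \<open>arccos\<close> lies in [-1, 1], where
  \<open>cos\<close> inverts it. For a zero vector both sides vanish.\<close>

lemma inner_eq_norm_cos_angle: "u \<bullet> v = norm u * norm v * cos (angle u v)"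
proof (cases "u = 0 \<or> v = 0")
  case False
  have "\<bar>(u \<bullet> v) / (norm u * norm v)\<bar> \<le> 1"
    using False Cauchy_Schwarz_ineq2[of u v] by (simp add: divide_simps)
  then have "cos (angle u v) = (u \<bullet> v) / (norm u * norm v)"
    unfolding angle_def by (simp add: cos_arccos_abs)
  then show ?thesis using False by simp
qed auto

lemma affine_on_interval_iff_deriv_const:
  fixes h h' :: "real \<Rightarrow> real"
  assumes "is_interval I" "interior I \<noteq> {}"
    and der: "\<And>s. s \<in> I \<Longrightarrow> (h has_real_derivative h' s) (at s within I)"
  shows "(\<exists>a b. \<forall>s\<in>I. h s = a * s + b) \<longleftrightarrow> (\<exists>a. \<forall>s\<in>I. h' s = a)"
proof
  assume "\<exists>a b. \<forall>s\<in>I. h s = a * s + b"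
  then obtain a b where ab: "\<And>s. s \<in> I \<Longrightarrow> h s = a * s + b" by blast
  have "h' s = a" if "s \<in> I" for s
  proof -
    have "((\<lambda>t. a * t + b) has_real_derivative a) (at s within I)"
      by (auto intro!: derivative_eq_intros)
    then have "(h has_real_derivative a) (at s within I)"
      using ab that
      \<comment> \<open>Any positive radius would do, since the two functions agree on all of
        \<open>I\<close>.\<close>
      by (auto intro: has_field_derivative_transform_within[where d = 1])
    then show ?thesis
      using der[OF that] at_within_interval_neq_bot[OF assms(1,2) that]
      by (metis has_field_derivative_unique)
  qed
  then show "\<exists>a. \<forall>s\<in>I. h' s = a" by blast
next
  assume "\<exists>a. \<forall>s\<in>I. h' s = a"
  then obtain a where a: "\<And>s. s \<in> I \<Longrightarrow> h' s = a" by blast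
  \<comment> \<open>Subtracting the candidate linear part leaves a function with zero derivative on
    a convex set, hence a constant.\<close>
  have "((\<lambda>t. h t - a * t) has_real_derivative 0) (at s within I)" if "s \<in> I" for s
    using der[OF that] a[OF that] by (auto intro!: derivative_eq_intros)
  then have "\<exists>b. \<forall>s\<in>I. h s - a * s = b"
    using has_field_derivative_zero_constant[of I "\<lambda>t. h t - a * t"] assms(1)
    by (auto simp: is_interval_convex)
  then show "\<exists>a b. \<forall>s\<in>I. h s = a * s + b" by (metis diff_eq_eq add.commute)
qed

theorem theorem3p1:
  fixes M :: "(real ^ 'n) set" and f :: "real ^ 'n \<Rightarrow> real"
    and \<alpha> :: "real \<Rightarrow> real ^ 'n" and I :: "real set" and k :: nat
  assumes "embedded_submanifold k M"
    and "smooth_map_on M f"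
    and "unit_speed_curve I M \<alpha>"
    and "eikonal_along M f I \<alpha>"
  shows "eikonal_helix M f I \<alpha> \<longleftrightarrow> linear_along f I \<alpha>"
proof -
  let ?T = "curve_tangent \<alpha> I" and ?g = "\<lambda>s. grad M f (\<alpha> s)"
  have I: "is_interval I" "interior I \<noteq> {}" "\<alpha> ` I \<subseteq> M" and T: "\<And>s. s \<in> I \<Longrightarrow> norm (?T s) = 1"
    using assms(3) by (auto simp: unit_speed_curve_def)
  obtain c where c: "\<And>s. s \<in> I \<Longrightarrow> norm (?g s) = c"
    using assms(4) by (auto simp: eikonal_along_def)
  have "((\<lambda>t. f (\<alpha> t)) has_real_derivative ?g s \<bullet> ?T s) (at s within I)" if "s \<in> I" for s
    using deriv_along_curve_eq_grad[OF assms(1,2)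
        unit_speed_curve_has_vector_derivative[OF assms(3) that]
        at_within_interval_neq_bot[OF I(1,2) that] that I(3)] .
  from affine_on_interval_iff_deriv_const[OF I(1,2) this]
  have "linear_along f I \<alpha> \<longleftrightarrow> (\<exists>a. \<forall>s\<in>I. ?g s \<bullet> ?T s = a)"
    by (simp add: linear_along_def)
  also have "\<dots> \<longleftrightarrow> (\<exists>\<theta>. \<forall>s\<in>I. angle (?g s) (?T s) = \<theta>)"
  proof
    assume "\<exists>a. \<forall>s\<in>I. ?g s \<bullet> ?T s = a"
    then obtain a where "\<forall>s\<in>I. ?g s \<bullet> ?T s = a" by blast
    \<comment> \<open>The norms are \<open>c\<close> and 1. If \<open>c\<close> is 0, the quotient
      is 0 by convention, and the angle is still constant.\<close>
    then have "\<forall>s\<in>I. angle (?g s) (?T s) = arccos (a / c)"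
      by (simp add: angle_def c T)
    then show "\<exists>\<theta>. \<forall>s\<in>I. angle (?g s) (?T s) = \<theta>" by blast
  next
    assume "\<exists>\<theta>. \<forall>s\<in>I. angle (?g s) (?T s) = \<theta>"
    then obtain \<theta> where "\<forall>s\<in>I. angle (?g s) (?T s) = \<theta>" by blast
    then have "\<forall>s\<in>I. ?g s \<bullet> ?T s = c * cos \<theta>"
      by (simp add: inner_eq_norm_cos_angle c T)
    then show "\<exists>a. \<forall>s\<in>I. ?g s \<bullet> ?T s = a" by blast
  qed
  also have "\<dots> \<longleftrightarrow> eikonal_helix M f I \<alpha>"
    using assms(4) by (simp add: eikonal_helix_def)
  finally show ?thesis by blast
qed

end
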